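(* Let $\theta_1<\theta_2$ be real numbers with $|\theta_j|\le \pi/2$ for $j=1,2$. Then there exists a (non-elliptic) semigroup $(\phi_t)_{t\ge 0}$ of holomorphic self-mappings of the unit disk $\mathbb{D}$ such that, for every $z\in\mathbb{D}$, $$\mathrm{Slope}^+(\gamma_z)=[\theta_1,\theta_2].$$
   Context: A (one-parameter continuous) semigroup of holomorphic functions is a family $(\phi_t)_{t\in[0,\infty)}$ of holomorphic maps $\phi_t:\mathbb{D}\to\mathbb{D}$, where $\mathbb{D}$ is the open unit disk in $\mathbb{C}$, such that (i) $\phi_{t+s}=\phi_t\circ\phi_s$ for all $t,s\ge 0$; (ii) $\phi_0(z)=z$ for all $z\in\mathbb{D}$; (iii) $\lim_{t\to s}\phi_t(z)=\phi_s(z)$ for all $s\ge 0$ and $z\in\mathbb{D}$. It is non-elliptic if it has no fixed point in $\mathbb{D}$ (all semigroups considered are non-elliptic). For a non-elliptic semigroup there is a unique point $\xi\in\partial\mathbb{D}$, the Denjoy-Wolff point, such that $\lim_{t\to\infty}\phi_t(z)=\xi$ for every $z\in\mathbb{D}$. There is also a conformal (biholomorphic) map $h:\mathbb{D}\to\Omega$ onto a planar domain $\Omega=h(\mathbb{D})$ with $h(\phi_t(z))=h(z)+t$ for all $z\in\mathbb{D}$, $t\ge 0$ (the Koenigs function, and the associated planar domain). For $z\in\mathbb{D}$ let $T=\inf\{t\in\mathbb{R}: h(z)+t\in\Omega\}\in[-\infty,0)$; the (extended) trajectory of $z$ is the curve $\gamma_z:(T,+\infty)\to\mathbb{D}$,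 $\gamma_z(t)=h^{-1}(h(z)+t)$, so that $\gamma_z(t)=\phi_t(z)$ for $t\ge 0$. $\mathrm{Slope}^+(\gamma_z)$ is the set of all $\theta\in\mathbb{R}$ for which there exists a strictly increasing sequence $t_n\to+\infty$ with $\arg(1-\overline{\xi}\,\gamma_z(t_n))\to\theta$, where $\arg$ takes values in $(-\pi/2,\pi/2)$ (note that $1-\overline{\xi}\,\gamma_z(t)$ has positive real part). Thus $\mathrm{Slope}^+(\gamma_z)\subset[-\pi/2,\pi/2]$. *)

theory Defs
  imports "HOL-Complex_Analysis.Complex_Analysis"
begin

abbreviation unit_disk :: "complex set" where
  "unit_disk \<equiv> ball 0 1"

text \<open>The time parameter ranges over \<open>[0, \<infinity>)\<close> and the space variable over the unit disk;
  values of \<open>\<phi>\<close> at negative times or outside the disk are irrelevant.\<close>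

definition holo_semigroup :: "(real \<Rightarrow> complex \<Rightarrow> complex) \<Rightarrow> bool" where
  "holo_semigroup \<phi> \<longleftrightarrow>
     (\<forall>t\<ge>0. \<phi> t holomorphic_on unit_disk \<and> \<phi> t ` unit_disk \<subseteq> unit_disk) \<and>
     (\<forall>t\<ge>0. \<forall>s\<ge>0. \<forall>z\<in>unit_disk. \<phi> (t + s) z = \<phi> t (\<phi> s z)) \<and>
     (\<forall>z\<in>unit_disk. \<phi> 0 z = z) \<and>
     (\<forall>s\<ge>0. \<forall>z\<in>unit_disk. ((\<lambda>t. \<phi> t z) \<longlongrightarrow> \<phi> s z) (at s within {0..}))"

text \<open>A fixed point of the semigroup is a common fixed point of all its members.\<close>

definition non_elliptic :: "(real \<Rightarrow> complex \<Rightarrow> complex) \<Rightarrow> bool" where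
  "non_elliptic \<phi> \<longleftrightarrow> \<not> (\<exists>z\<in>unit_disk. \<forall>t\<ge>0. \<phi> t z = z)"

definition is_denjoy_wolff_point :: "(real \<Rightarrow> complex \<Rightarrow> complex) \<Rightarrow> complex \<Rightarrow> bool" where
  "is_denjoy_wolff_point \<phi> \<xi> \<longleftrightarrow>
     \<xi> \<in> sphere 0 1 \<and> (\<forall>z\<in>unit_disk. ((\<lambda>t. \<phi> t z) \<longlongrightarrow> \<xi>) at_top)"

text \<open>The Koenigs domain is the image \<open>h ` unit_disk\<close>; it is open and connected because \<open>h\<close> is
  holomorphic and injective.\<close>

definition is_koenigs_function ::
    "(real \<Rightarrow> complex \<Rightarrow> complex) \<Rightarrow> (complex \<Rightarrow> complex) \<Rightarrow> bool" where
  "is_koenigs_function \<phi> h \<longleftrightarrow>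
     h holomorphic_on unit_disk \<and> inj_on h unit_disk \<and>
     inv_into unit_disk h holomorphic_on h ` unit_disk \<and>
     (\<forall>z\<in>unit_disk. \<forall>t\<ge>0. h (\<phi> t z) = h z + of_real t)"

definition trajectory_start :: "(complex \<Rightarrow> complex) \<Rightarrow> complex \<Rightarrow> ereal" where
  "trajectory_start h z = Inf {ereal t | t. h z + of_real t \<in> h ` unit_disk}"

text \<open>Meaningful only for \<open>t\<close> with \<open>trajectory_start h z < ereal t\<close>.\<close>

definition trajectory :: "(complex \<Rightarrow> complex) \<Rightarrow> complex \<Rightarrow> real \<Rightarrow> complex" where
  "trajectory h z t = inv_into unit_disk h (h z + of_real t)"

text \<open>Since \<open>1 - cnj \<xi> * trajectory h z t\<close> has positive real part, the principal argument
  \<open>Arg\<close> takes values in \<open>(-\<pi>/2, \<pi>/2)\<close> here.\<close>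

definition slope_plus :: "complex \<Rightarrow> (complex \<Rightarrow> complex) \<Rightarrow> complex \<Rightarrow> real set" where
  "slope_plus \<xi> h z =
     {\<theta>. \<exists>t :: nat \<Rightarrow> real. strict_mono t \<and> (\<forall>n. trajectory_start h z < ereal (t n)) \<and>
          filterlim t at_top sequentially \<and>
          (\<lambda>n. Arg (1 - cnj \<xi> * trajectory h z (t n))) \<longlonglongrightarrow> \<theta>}"

text \<open>The Denjoy--Wolff point is determined by the semigroup, and so is the forward trajectory,
  whichever Koenigs function is used.\<close>

lemma denjoy_wolff_point_unique:
  assumes "is_denjoy_wolff_point \<phi> \<xi>" "is_denjoy_wolff_point \<phi> \<xi>'"
  shows "\<xi> = \<xi>'"
proof -
  have "((\<lambda>t. \<phi> t 0) \<longlongrightarrow> \<xi>) at_top" "((\<lambda>t. \<phi> t 0) \<longlongrightarrow> \<xi>') at_top"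
    using assms by (auto simp: is_denjoy_wolff_point_def)
  then show ?thesis
    using tendsto_unique trivial_limit_at_top_linorder by blast
qed

lemma trajectory_eq_semigroup:
  assumes "holo_semigroup \<phi>" "is_koenigs_function \<phi> h" "z \<in> unit_disk" "t \<ge> 0"
  shows "trajectory h z t = \<phi> t z"
proof -
  have "\<phi> t z \<in> unit_disk"
    using assms(1,3,4) unfolding holo_semigroup_def by blast
  moreover have "h z + of_real t = h (\<phi> t z)" "inj_on h unit_disk"
    using assms(2-4) unfolding is_koenigs_function_def by auto
  ultimately show ?thesis
    by (simp add: trajectory_def inv_into_f_f)
qed

end

theory Submission
  imports Defs
begin

text \<open>
  The semigroup is built from its Koenigs function, and the Koenigs function from the direction in
  which the trajectories are wanted to go. Move the disk to a half plane \<open>Re w > R\<close> by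
  \<open>w = 2 R / (1 - z)\<close>. The boundary point \<open>1\<close> goes to infinity and \<open>Arg (1 - z) = - Arg w\<close>, so
  that only \<open>Arg w\<close> along the trajectories has to be controlled.

  Let \<open>h\<close> be holomorphic on the half plane with \<open>Re h' > 0\<close> and \<open>h \<longrightarrow> \<infinity>\<close> at infinity. Then all
  difference quotients of \<open>h\<close> have positive real part (\<open>Re_difference_quotient_pos\<close>). Hence \<open>h\<close> is
  injective, and moving to the right in the image moves to the right in the half plane; together with
  \<open>h \<longrightarrow> \<infinity>\<close> this keeps the preimage of a horizontal ray away from the boundary, so the image
  contains with every point the horizontal ray to its right (\<open>horizontal_ray_in_image\<close>). Translation
  in the image is therefore a semigroup with Koenigs function \<open>h\<close> (\<open>semigroup_of_koenigs_domain\<close>),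
  and its trajectories, the curves \<open>h w = c + t\<close>, tend to infinity (\<open>curve_escapes_to_infinity\<close>).

  To make a trajectory follow a slowly varying direction \<open>g\<close>, take
  \<open>h w = exp ((Ln w - \<i> g) / 2)\<close>, a square root of \<open>w exp (- \<i> g)\<close>. Along \<open>h w = c + t\<close> one has
  \<open>Arg (h w) \<longrightarrow> 0\<close>, that is \<open>Arg w - Re g \<longrightarrow> 0\<close>. With \<open>\<zeta> = Ln (Ln w)\<close> and
  \<open>g = m + d sin \<zeta>\<close> the direction oscillates for ever between \<open>m - d\<close> and \<open>m + d\<close>, because
  \<open>Im \<zeta> \<longrightarrow> 0\<close> and \<open>Re \<zeta> \<longrightarrow> \<infinity>\<close> continuously; so the limit directions are exactly the points of
  \<open>[m - d, m + d]\<close>, for every starting point (\<open>direction_of_trajectory\<close>,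
  \<open>slope_plus_of_oscillation\<close>), and the slopes are their negatives.

  It remains to have \<open>Re h' > 0\<close>. The argument of \<open>h'\<close> is \<open>- (Im (Ln w) + Re g) / 2\<close> up to an error
  that comes from the derivative of \<open>g\<close> and is of order \<open>1 / \<bar>Ln w\<bar>\<close>. The main term stays in
  \<open>[-\<pi>/2, \<pi>/2]\<close> if \<open>\<bar>Re g\<bar> \<le> \<pi>/2\<close>, but if one of the prescribed slopes is \<open>\<plusminus>\<pi>/2\<close> nothing is
  left for the error. The factor \<open>1 - 1 / \<zeta>\<close> in \<open>damped_sine\<close> provides the room: it does not change
  the limit directions, and it lowers the bound on \<open>\<bar>Re g\<bar>\<close> by an amount of order \<open>1 / Re \<zeta>\<close>, where
  \<open>Re \<zeta> = ln \<bar>Ln w\<bar>\<close>, which far out is much larger than the error (\<open>Re_damped_sine_slack\<close>).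
\<close>

section \<open>Holomorphic functions whose derivative has positive real part\<close>

text \<open>The difference quotient is an average of \<open>f'\<close> over the segment from \<open>a\<close> to \<open>b\<close>. This is the
  Noshiro--Warschawski univalence criterion in a quantitative form: besides injectivity it gives
  control of the direction of \<open>b - a\<close> from that of \<open>f b - f a\<close>.\<close>

lemma Re_difference_quotient_pos:
  fixes f :: "complex \<Rightarrow> complex"
  assumes "f holomorphic_on S" "open S" "convex S"
    and pos: "\<And>z. z \<in> S \<Longrightarrow> 0 < Re (deriv f z)"
    and "a \<in> S" "b \<in> S" "a \<noteq> b"
  shows "0 < Re ((f b - f a) / (b - a))"
proof -
  define p where "p = (\<lambda>s. a + of_real s * (b - a))"
  define g where "g = (\<lambda>s. Re ((f (p s) - f a) / (b - a)))"
  have pS: "p s \<in> S" if "0 \<le> s" "s \<le> 1" for s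
  proof -
    have "p s = (1 - s) *\<^sub>R a + s *\<^sub>R b"
      by (simp add: p_def scaleR_conv_of_real algebra_simps)
    then show ?thesis using assms that convexD_alt[of S a b s] by simp
  qed
  have der: "(g has_real_derivative Re (deriv f (p s))) (at s)" if "0 \<le> s" "s \<le> 1" for s
  proof -
    have "(f has_field_derivative deriv f (p s)) (at (p s))"
      using assms pS[OF that] holomorphic_derivI by blast
    moreover have "(p has_vector_derivative (b - a)) (at s)"
      unfolding p_def by (auto intro!: derivative_eq_intros simp: has_vector_derivative_def scaleR_conv_of_real)
    ultimately have "((f \<circ> p) has_vector_derivative (b - a) * deriv f (p s)) (at s)"
      by (rule field_vector_diff_chain_at[rotated])
    then have "((\<lambda>s. (f (p s) - f a) / (b - a)) has_vector_derivative ((b - a) * deriv f (p s) - 0) / (b - a)) (at s)"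
      unfolding o_def
      by (intro has_vector_derivative_divide has_vector_derivative_diff has_vector_derivative_const)
    then have "((\<lambda>s. (f (p s) - f a) / (b - a)) has_vector_derivative deriv f (p s)) (at s)"
      using \<open>a \<noteq> b\<close> by simp
    then show ?thesis
      unfolding g_def has_real_derivative_iff_has_vector_derivative
      using bounded_linear.has_vector_derivative[OF bounded_linear_Re] by blast
  qed
  obtain s where s: "0 < s" "s < 1" "g 1 - g 0 = (1 - 0) * Re (deriv f (p s))"
    using MVT2[of 0 1 g "\<lambda>s. Re (deriv f (p s))"] der by auto
  then have "g 1 - g 0 > 0" using pos[OF pS] by simp
  then show ?thesis by (simp add: g_def p_def)
qed

text \<open>If \<open>h w = h w0 + s\<close> with \<open>s > 0\<close>, then \<open>s / (w - w0)\<close> has positive real part, so \<open>w\<close> lies to the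
  right of \<open>w0\<close>. Preimages of points of the ray thus lie in the closed half plane
  \<open>Re w \<ge> Re w0\<close>, whose image is closed since \<open>h\<close> is proper there. The set of times at which the
  ray is in the image is therefore open and closed in \<open>[0, \<infinity>)\<close>.\<close>

lemma horizontal_ray_in_image:
  fixes h :: "complex \<Rightarrow> complex" and R :: real
  defines "P \<equiv> {w. R < Re w}"
  assumes hol: "h holomorphic_on P" and inj: "inj_on h P"
    and dq: "\<And>a b. \<lbrakk>a \<in> P; b \<in> P; a \<noteq> b\<rbrakk> \<Longrightarrow> 0 < Re ((h b - h a) / (b - a))"
    and proper: "\<And>B. \<exists>C. \<forall>w\<in>P. norm (h w) \<le> B \<longrightarrow> norm w \<le> C"
    and w0: "w0 \<in> P" and "0 \<le> t"
  shows "\<exists>w\<in>P. Re w0 \<le> Re w \<and> h w = h w0 + of_real t"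
proof -
  define E where "E = {w. Re w0 \<le> Re w}"
  have EP: "E \<subseteq> P" using w0 by (auto simp: E_def P_def)
  have mono: "w \<in> E" if "w \<in> P" "h w = h w0 + of_real s" "0 \<le> s" for w s
  proof (cases "w = w0")
    case False
    then have "0 < Re (of_real s / (w - w0))"
      using dq[OF w0 \<open>w \<in> P\<close>] that by simp
    then have "0 < s * Re (w - w0)"
      by (simp add: Re_divide zero_less_divide_iff zero_less_mult_iff not_sum_power2_lt_zero)
    then show ?thesis using \<open>0 \<le> s\<close> by (simp add: E_def zero_less_mult_iff)
  qed (simp add: E_def)
  have contE: "continuous_on E h"
    using hol EP holomorphic_on_imp_continuous_on continuous_on_subset by blast
  have closed_hE: "closed (h ` E)"
    unfolding closed_sequential_limits
  proof (intro allI impI, elim conjE)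
    fix y l assume y: "\<forall>n. y n \<in> h ` E" and l: "y \<longlonglongrightarrow> l"
    obtain B where B: "\<And>n. norm (y n) \<le> B"
      using convergent_imp_Bseq l BseqE convergentI by metis
    obtain C where C: "\<And>w. w \<in> P \<Longrightarrow> norm (h w) \<le> B \<Longrightarrow> norm w \<le> C"
      using proper by blast
    have "closed E" unfolding E_def by (rule closed_halfspace_Re_ge)
    then have "compact (E \<inter> cball 0 C)"
      by (simp add: closed_Int_compact)
    then have "compact (h ` (E \<inter> cball 0 C))"
      by (rule compact_continuous_image[rotated]) (use contE continuous_on_subset in blast)
    moreover have "y n \<in> h ` (E \<inter> cball 0 C)" for n
    proof -
      obtain w where "w \<in> E" "y n = h w" using y by blast
      moreover have "norm w \<le> C" using C[of w] B[of n] EP calculation by auto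
      ultimately show ?thesis by simp
    qed
    ultimately have "l \<in> h ` (E \<inter> cball 0 C)"
      using l closed_sequentially compact_imp_closed by metis
    then show "l \<in> h ` E" by blast
  qed
  have open_hP: "open (h ` P)"
    using open_mapping_thm3[OF hol _ inj] unfolding P_def by (simp add: open_halfspace_Re_gt)
  define S where "S = {s\<in>{0..}. h w0 + of_real s \<in> h ` P}"
  have S_alt: "S = {s\<in>{0..}. h w0 + of_real s \<in> h ` E}" unfolding S_def
  proof (intro Collect_cong conj_cong refl iffI)
    fix s :: real assume "s \<in> {0..}" "h w0 + of_real s \<in> h ` P"
    then show "h w0 + of_real s \<in> h ` E" using mono[of _ s] by (auto simp: image_iff)
  qed (use EP in blast)
  have cont: "continuous_on {0..} (\<lambda>s::real. h w0 + of_real s)"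
    by (intro continuous_intros)
  have "openin (top_of_set {0..}) S"
    using continuous_openin_preimage_gen[OF cont open_hP] unfolding S_def
    by (simp add: vimage_def Int_def conj_commute)
  moreover have "closedin (top_of_set {0..}) S"
    using continuous_closedin_preimage[OF cont closed_hE] unfolding S_alt
    by (simp add: vimage_def Int_def conj_commute)
  moreover have "0 \<in> S" using w0 by (auto simp: S_def)
  ultimately have "S = {0..}"
    using connected_clopen[of "{0::real..}"] by (metis connected_Ici empty_iff)
  then have "t \<in> S" using \<open>0 \<le> t\<close> by simp
  then obtain w where "w \<in> E" "h w0 + of_real t = h w" unfolding S_alt by blast
  then show ?thesis using EP by (intro bexI[of _ w]) (auto simp: E_def)
qed

section \<open>Semigroups given by a Koenigs domain\<close>

lemma holomorphic_inv_into:
  assumes "f holomorphic_on S" "open S" "inj_on f S"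
  shows "inv_into S f holomorphic_on f ` S"
proof -
  obtain g where g: "g holomorphic_on f ` S" "\<And>z. z \<in> S \<Longrightarrow> g (f z) = z"
    using holomorphic_has_inverse[OF assms] by metis
  show ?thesis
    by (rule holomorphic_transform[OF g(1)]) (use g(2) assms(3) in \<open>auto simp: inv_into_f_f\<close>)
qed

lemma semigroup_of_koenigs_domain:
  fixes H :: "complex \<Rightarrow> complex"
  defines "\<phi> \<equiv> \<lambda>t z. inv_into unit_disk H (H z + of_real t)"
  assumes hol: "H holomorphic_on unit_disk" and inj: "inj_on H unit_disk"
    and ray: "\<forall>z\<in>unit_disk. \<forall>t\<ge>0. H z + of_real t \<in> H ` unit_disk"
  shows "holo_semigroup \<phi>" "non_elliptic \<phi>" "is_koenigs_function \<phi> H"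
    "\<And>z. z \<in> unit_disk \<Longrightarrow> continuous_on {0..} (\<lambda>t. \<phi> t z)"
proof -
  have inv: "inv_into unit_disk H holomorphic_on H ` unit_disk"
    by (rule holomorphic_inv_into[OF hol _ inj]) simp
  have in_disk: "\<phi> t z \<in> unit_disk" and H\<phi>: "H (\<phi> t z) = H z + of_real t"
    if "z \<in> unit_disk" "0 \<le> t" for t z
    using ray[rule_format, OF that] by (simp_all only: \<phi>_def inv_into_into f_inv_into_f)
  show cont: "continuous_on {0..} (\<lambda>t. \<phi> t z)" if "z \<in> unit_disk" for z
    unfolding \<phi>_def
    by (rule continuous_on_compose2[OF holomorphic_on_imp_continuous_on[OF inv]])
       (use ray that in \<open>auto intro!: continuous_intros simp del: mem_ball\<close>)
  show "holo_semigroup \<phi>"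
    unfolding holo_semigroup_def
  proof (intro conjI allI impI ballI)
    fix t :: real assume t: "0 \<le> t"
    have "(inv_into unit_disk H \<circ> (\<lambda>z. H z + of_real t)) holomorphic_on unit_disk"
      by (rule holomorphic_on_compose_gen[OF _ inv])
         (use ray t hol in \<open>auto intro!: holomorphic_intros simp del: mem_ball\<close>)
    then show "\<phi> t holomorphic_on unit_disk" by (simp add: \<phi>_def o_def)
    show "\<phi> t ` unit_disk \<subseteq> unit_disk" using in_disk t by blast
  next
    fix t s :: real and z assume "0 \<le> t" "0 \<le> s" "z \<in> unit_disk"
    then show "\<phi> (t + s) z = \<phi> t (\<phi> s z)"
      using H\<phi>[of z s] by (simp add: \<phi>_def add_ac)
  next
    fix z assume "z \<in> unit_disk"
    then show "\<phi> 0 z = z" using inj by (simp add: \<phi>_def inv_into_f_f)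
  next
    fix s z assume "0 \<le> (s::real)" "z \<in> unit_disk"
    then show "((\<lambda>t. \<phi> t z) \<longlongrightarrow> \<phi> s z) (at s within {0..})"
      using cont by (auto simp: continuous_on_def)
  qed
  show "non_elliptic \<phi>"
    unfolding non_elliptic_def
  proof (intro notI, elim bexE)
    fix z assume "z \<in> unit_disk" "\<forall>t\<ge>0. \<phi> t z = z"
    then show False using H\<phi>[of z 1] by auto
  qed
  show "is_koenigs_function \<phi> H"
    unfolding is_koenigs_function_def using hol inj inv H\<phi> by blast
qed

section \<open>Limit directions of an oscillating trajectory\<close>

text \<open>No cluster value lies outside the range of the oscillation. Conversely, the phase \<open>x\<close> is
  continuous and unbounded and therefore takes every value \<open>\<alpha> + 2 \<pi> k\<close> with \<open>k\<close> large, so each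
  value of the oscillation recurs at arbitrarily late times.\<close>

lemma slope_plus_of_oscillation:
  fixes x :: "real \<Rightarrow> real"
  assumes z: "z \<in> unit_disk" and "0 < d"
    and cont: "continuous_on {0..} x" and lim: "filterlim x at_top at_top"
    and osc: "((\<lambda>t. Arg (1 - cnj \<xi> * trajectory h z t) - (m - d * sin (x t))) \<longlongrightarrow> 0) at_top"
  shows "slope_plus \<xi> h z = {m - d..m + d}"
proof -
  let ?A = "\<lambda>t. Arg (1 - cnj \<xi> * trajectory h z t)"
  have lim_iff: "(\<lambda>n. ?A (t n)) \<longlonglongrightarrow> \<theta> \<longleftrightarrow> (\<lambda>n. m - d * sin (x (t n))) \<longlonglongrightarrow> \<theta>"
    if "filterlim t at_top sequentially" for t :: "nat \<Rightarrow> real" and \<theta>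
  proof -
    have *: "(\<lambda>n. ?A (t n) - (m - d * sin (x (t n)))) \<longlonglongrightarrow> 0"
      using filterlim_compose[OF osc that] .
    show ?thesis
      using tendsto_add[OF *, of "\<lambda>n. m - d * sin (x (t n))" \<theta>]
        tendsto_diff[of "\<lambda>n. ?A (t n)" \<theta>, OF _ *] by auto
  qed
  show ?thesis
  proof (intro equalityI subsetI)
    fix \<theta> assume "\<theta> \<in> slope_plus \<xi> h z"
    then obtain t :: "nat \<Rightarrow> real" where "filterlim t at_top sequentially" "(\<lambda>n. ?A (t n)) \<longlonglongrightarrow> \<theta>"
      unfolding slope_plus_def by blast
    then have *: "(\<lambda>n. m - d * sin (x (t n))) \<longlonglongrightarrow> \<theta>" using lim_iff by blast
    have "m - d * sin y \<in> {m - d..m + d}" for y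
      using mult_left_mono[OF sin_le_one[of y], of d] mult_left_mono[OF sin_ge_minus_one[of y], of d]
        \<open>0 < d\<close> by auto
    then show "\<theta> \<in> {m - d..m + d}"
      using closed_sequentially[OF _ _ *] closed_atLeastAtMost by blast
  next
    fix \<theta> assume \<theta>: "\<theta> \<in> {m - d..m + d}"
    define \<alpha> where "\<alpha> = arcsin ((m - \<theta>) / d)"
    have "sin \<alpha> = (m - \<theta>) / d"
      unfolding \<alpha>_def using \<theta> \<open>0 < d\<close> by (intro sin_arcsin) (auto simp: field_simps)
    then have \<alpha>: "m - d * sin \<alpha> = \<theta>" using \<open>0 < d\<close> by simp
    have later: "\<exists>t\<ge>T. sin (x t) = sin \<alpha>" if "0 \<le> T" for T
    proof -
      obtain k :: nat where k: "(x T - \<alpha>) / (2 * pi) \<le> real k"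
        using real_arch_simple by blast
      define y where "y = \<alpha> + 2 * real k * pi"
      have "x T \<le> y" using k by (simp add: y_def field_simps)
      obtain T' where T': "T \<le> T'" "y \<le> x T'"
        using lim unfolding filterlim_at_top eventually_at_top_linorder by (metis nle_le)
      have "continuous_on {T..T'} x"
        using cont \<open>0 \<le> T\<close> by (auto elim: continuous_on_subset)
      then obtain t where "T \<le> t" "x t = y"
        using IVT'[of x T y T'] \<open>x T \<le> y\<close> T' by blast
      moreover have "sin y = sin \<alpha>"
        by (simp add: y_def sin_add)
      ultimately show ?thesis by blast
    qed
    \<comment> \<open>Times at least one apart, so that the sequence increases to infinity; all are positive and
      hence lie after the start of the trajectory.\<close>
    have "\<exists>t. \<forall>n. (1 \<le> t n \<and> sin (x (t n)) = sin \<alpha>) \<and> t n + 1 \<le> t (Suc n)"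
    proof (rule dependent_nat_choice)
      show "\<exists>t. 1 \<le> t \<and> sin (x t) = sin \<alpha>" using later[of 1] by auto
      show "\<exists>t'. (1 \<le> t' \<and> sin (x t') = sin \<alpha>) \<and> t + 1 \<le> t'"
        if "1 \<le> t \<and> sin (x t) = sin \<alpha>" for t
        using later[of "t + 1"] that by (metis add_increasing2 order.trans zero_le_one)
    qed
    then obtain t :: "nat \<Rightarrow> real" where t: "\<And>n. 1 \<le> t n" "\<And>n. sin (x (t n)) = sin \<alpha>"
        "\<And>n. t n + 1 \<le> t (Suc n)" by blast
    have grow: "real n \<le> t n" for n
    proof (induction n)
      case (Suc n) then show ?case using t(3)[of n] by simp
    qed (use t(1)[of 0] in simp)
    have "filterlim t at_top sequentially"
      by (rule filterlim_at_top_mono[OF filterlim_real_sequentially]) (use grow in simp)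
    moreover have "strict_mono t"
      unfolding strict_mono_Suc_iff
      using t(3) by (intro allI less_le_trans[OF less_add_one])
    moreover have "trajectory_start h z < ereal (t n)" for n
    proof -
      have "trajectory_start h z \<le> ereal 0"
        unfolding trajectory_start_def using z by (intro Inf_lower) force
      also have "\<dots> < ereal (t n)" using t(1)[of n] by simp
      finally show ?thesis .
    qed
    moreover have "(\<lambda>n. m - d * sin (x (t n))) \<longlonglongrightarrow> \<theta>" using t(2) \<alpha> by simp
    ultimately show "\<theta> \<in> slope_plus \<xi> h z"
      unfolding slope_plus_def using lim_iff by blast
  qed
qed

section \<open>The damped sine near the real axis\<close>

lemma norm_sin_cos_le_exp:
  fixes z :: complex
  shows "norm (sin z) \<le> exp \<bar>Im z\<bar>" "norm (cos z) \<le> exp \<bar>Im z\<bar>"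
proof -
  have *: "norm (exp (\<i> * z)) \<le> exp \<bar>Im z\<bar>" "norm (exp (- (\<i> * z))) \<le> exp \<bar>Im z\<bar>"
    by (simp_all only: norm_exp_eq_Re) auto
  show "norm (sin z) \<le> exp \<bar>Im z\<bar>"
    using norm_triangle_ineq4[of "exp (\<i> * z)" "exp (- (\<i> * z))"] *
    by (simp add: sin_exp_eq norm_divide norm_mult del: norm_exp_eq_Re)
  show "norm (cos z) \<le> exp \<bar>Im z\<bar>"
    using norm_triangle_ineq[of "exp (\<i> * z)" "exp (- (\<i> * z))"] *
    by (simp add: cos_exp_eq norm_divide norm_mult del: norm_exp_eq_Re)
qed

lemma norm_sin_diff_Re_le:
  fixes z :: complex
  assumes "\<bar>Im z\<bar> \<le> 1"
  shows "norm (sin z - of_real (sin (Re z))) \<le> 3 * \<bar>Im z\<bar>"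
proof -
  let ?S = "{z. Im z \<le> 1} \<inter> {z. - 1 \<le> Im z}"
  have "norm (sin z - sin (of_real (Re z))) \<le> 3 * norm (z - of_real (Re z))"
  proof (rule field_differentiable_bound[of ?S])
    show "convex ?S"
      by (intro convex_Int convex_halfspace_Im_le convex_halfspace_Im_ge)
    show "(sin has_field_derivative cos y) (at y within ?S)" for y :: complex
      using DERIV_sin has_field_derivative_at_within by blast
    show "norm (cos y) \<le> 3" if "y \<in> ?S" for y
    proof -
      have "norm (cos y) \<le> exp \<bar>Im y\<bar>" by (rule norm_sin_cos_le_exp)
      also have "\<dots> \<le> exp 1" using that by auto
      finally show ?thesis using exp_le by linarith
    qed
  qed (use assms in auto)
  moreover have "norm (z - of_real (Re z)) = \<bar>Im z\<bar>"
    by (simp add: cmod_def)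
  ultimately show ?thesis by (simp add: sin_of_real)
qed

text \<open>For real \<open>\<zeta>\<close> the left-hand side is \<open>1 - 1 / \<zeta>\<close>. Half of the gain \<open>1 / \<zeta>\<close> survives in the strip
  \<open>\<bar>Im \<zeta>\<bar> \<le> 1\<close>.\<close>

lemma norm_one_minus_inverse_le:
  fixes \<zeta> :: complex
  assumes "2 \<le> Re \<zeta>" "\<bar>Im \<zeta>\<bar> \<le> 1"
  shows "norm (1 - 1 / \<zeta>) \<le> 1 - 1 / (2 * Re \<zeta>)"
proof -
  define x y c where "x = Re \<zeta>" and "y = Im \<zeta>" and "c = 1 / (2 * x)"
  have x: "2 \<le> x" and y: "y\<^sup>2 \<le> 1" and cx: "c * x = 1 / 2" and c: "0 \<le> c" "c \<le> 1"
    using assms by (auto simp: x_def y_def c_def abs_square_le_1 field_simps)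
  have "\<zeta> \<noteq> 0" using assms by auto
  have "(1 - c) * x = x - 1 / 2" using cx by (simp add: left_diff_distrib)
  then have "((1 - c) * x)\<^sup>2 = (x - 1 / 2)\<^sup>2" by simp
  moreover have "(x - 1)\<^sup>2 + 1 \<le> (x - 1 / 2)\<^sup>2"
    using x by (simp add: power2_eq_square algebra_simps)
  moreover have "0 \<le> ((1 - c) * y)\<^sup>2" by simp
  ultimately have "(x - 1)\<^sup>2 + y\<^sup>2 \<le> ((1 - c) * x)\<^sup>2 + ((1 - c) * y)\<^sup>2"
    using y by linarith
  also have "\<dots> = ((1 - c) * norm \<zeta>)\<^sup>2"
    unfolding power_mult_distrib cmod_power2 x_def y_def by (simp add: distrib_left)
  finally have "(norm (\<zeta> - 1))\<^sup>2 \<le> ((1 - c) * norm \<zeta>)\<^sup>2"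
    by (simp add: cmod_power2 x_def y_def)
  then have "norm (\<zeta> - 1) \<le> (1 - c) * norm \<zeta>"
    by (rule power2_le_imp_le) (use c in simp)
  moreover have "1 - 1 / \<zeta> = (\<zeta> - 1) / \<zeta>" using \<open>\<zeta> \<noteq> 0\<close> by (simp add: field_simps)
  ultimately show ?thesis
    using \<open>\<zeta> \<noteq> 0\<close> by (simp add: norm_divide c_def x_def divide_le_eq)
qed

text \<open>The direction of the trajectories at \<open>w\<close>, as a function of \<open>\<zeta> = Ln (Ln w)\<close>. The factor
  \<open>1 - 1 / \<zeta>\<close> keeps the amplitude slightly below its limit.\<close>

definition damped_sine :: "real \<Rightarrow> real \<Rightarrow> complex \<Rightarrow> complex" where
  "damped_sine m d \<zeta> = (1 - 1 / \<zeta>) * (of_real m + of_real d * sin \<zeta>)"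

context
  fixes m d :: real and \<zeta> :: complex
  assumes md: "0 \<le> d" "\<bar>m\<bar> + d \<le> pi / 2" and \<zeta>: "2 \<le> Re \<zeta>" "\<bar>Im \<zeta>\<bar> \<le> 1"
begin

lemma norm_affine_sine_le:
  "norm (of_real m + of_real d * sin \<zeta>) \<le> (pi / 2) * (1 + 2 * \<bar>Im \<zeta>\<bar>)"
proof -
  have "(Im \<zeta>)\<^sup>2 \<le> \<bar>Im \<zeta>\<bar>"
    using \<zeta>(2) mult_left_le_one_le[of "\<bar>Im \<zeta>\<bar>" "\<bar>Im \<zeta>\<bar>"] by (simp add: power2_eq_square)
  then have "norm (sin \<zeta>) \<le> 1 + 2 * \<bar>Im \<zeta>\<bar>"
    using norm_sin_cos_le_exp(1)[of \<zeta>] exp_bound[of "\<bar>Im \<zeta>\<bar>"] \<zeta>(2) by simp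
  then have "norm (of_real m + of_real d * sin \<zeta>) \<le> \<bar>m\<bar> + d * (1 + 2 * \<bar>Im \<zeta>\<bar>)"
    using md(1) norm_triangle_ineq[of "of_real m" "of_real d * sin \<zeta>"]
      mult_left_mono[of "norm (sin \<zeta>)" _ d] by (fastforce simp: norm_mult)
  also have "\<dots> \<le> (\<bar>m\<bar> + d) * (1 + 2 * \<bar>Im \<zeta>\<bar>)"
    by (simp add: algebra_simps)
  also have "\<dots> \<le> (pi / 2) * (1 + 2 * \<bar>Im \<zeta>\<bar>)"
    by (rule mult_right_mono) (use md in auto)
  finally show ?thesis .
qed

lemma norm_affine_sine_le_5: "norm (of_real m + of_real d * sin \<zeta>) \<le> 5"
proof -
  have "(pi / 2) * (1 + 2 * \<bar>Im \<zeta>\<bar>) \<le> (pi / 2) * 3"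
    using \<zeta>(2) by (intro mult_left_mono) auto
  moreover have "(pi / 2) * 3 \<le> 5" using pi_approx by simp
  ultimately show ?thesis using norm_affine_sine_le by linarith
qed

text \<open>The factor \<open>1 - 1 / (2 Re \<zeta>)\<close> is the gain from damping, the factor \<open>1 + 2 \<bar>Im \<zeta>\<bar>\<close> the loss from
  the growth of the sine off the real axis.\<close>

lemma norm_damped_sine_le:
  "norm (damped_sine m d \<zeta>) \<le> (pi / 2) * (1 - 1 / (2 * Re \<zeta>)) * (1 + 2 * \<bar>Im \<zeta>\<bar>)"
  using mult_mono[OF norm_one_minus_inverse_le[OF \<zeta>] norm_affine_sine_le] \<zeta>
  by (simp add: damped_sine_def norm_mult mult_ac)

lemma norm_damped_sine_le_5: "norm (damped_sine m d \<zeta>) \<le> 5"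
proof -
  have "0 \<le> 1 / (2 * Re \<zeta>)" using \<zeta>(1) by simp
  then have "norm (1 - 1 / \<zeta>) \<le> 1" using norm_one_minus_inverse_le[OF \<zeta>] by linarith
  then have "norm (damped_sine m d \<zeta>) \<le> 1 * 5"
    unfolding damped_sine_def norm_mult using norm_affine_sine_le_5 by (intro mult_mono) auto
  then show ?thesis by simp
qed

lemma damped_sine_near_sine:
  "norm (damped_sine m d \<zeta> - of_real (m + d * sin (Re \<zeta>))) \<le> 5 / Re \<zeta> + 5 * \<bar>Im \<zeta>\<bar>"
proof -
  let ?L = "of_real m + of_real d * sin \<zeta>"
  have L: "norm ?L \<le> 5" by (rule norm_affine_sine_le_5)
  have "norm (1 / \<zeta>) \<le> 1 / Re \<zeta>"
    using \<zeta>(1) complex_Re_le_cmod[of \<zeta>] by (simp add: norm_divide frac_le)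
  then have "norm (1 / \<zeta> * ?L) \<le> 1 / Re \<zeta> * 5"
    unfolding norm_mult using L \<zeta>(1) by (intro mult_mono) auto
  moreover have "norm (of_real d * (sin \<zeta> - of_real (sin (Re \<zeta>)))) \<le> (pi / 2) * (3 * \<bar>Im \<zeta>\<bar>)"
    unfolding norm_mult using md norm_sin_diff_Re_le[OF \<zeta>(2)] by (intro mult_mono) auto
  moreover have "(pi / 2) * (3 * \<bar>Im \<zeta>\<bar>) \<le> 5 * \<bar>Im \<zeta>\<bar>"
    using mult_right_mono[of "pi / 2 * 3" 5 "\<bar>Im \<zeta>\<bar>"] pi_approx by simp
  moreover have "damped_sine m d \<zeta> - of_real (m + d * sin (Re \<zeta>)) =
      of_real d * (sin \<zeta> - of_real (sin (Re \<zeta>))) - 1 / \<zeta> * ?L"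
    by (simp add: damped_sine_def algebra_simps)
  ultimately show ?thesis
    using norm_triangle_ineq4[of "of_real d * (sin \<zeta> - of_real (sin (Re \<zeta>)))" "1 / \<zeta> * ?L"]
    by simp
qed

lemma damped_sine_derivative:
  obtains D where "(damped_sine m d has_field_derivative D) (at \<zeta>)" "norm D \<le> 10"
proof
  let ?L = "of_real m + of_real d * sin \<zeta>"
  let ?D = "1 / \<zeta>\<^sup>2 * ?L + (1 - 1 / \<zeta>) * (of_real d * cos \<zeta>)"
  have "\<zeta> \<noteq> 0" using \<zeta> by auto
  then show "(damped_sine m d has_field_derivative ?D) (at \<zeta>)"
    unfolding damped_sine_def
    by (auto intro!: derivative_eq_intros simp: power2_eq_square)
  have L: "norm ?L \<le> 5" by (rule norm_affine_sine_le_5)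
  have "1 \<le> norm \<zeta>" using \<zeta>(1) complex_Re_le_cmod[of \<zeta>] by simp
  then have "norm (1 / \<zeta>\<^sup>2) \<le> 1"
    using one_le_power[of "norm \<zeta>" 2] by (simp add: norm_divide norm_power divide_le_eq)
  then have 1: "norm (1 / \<zeta>\<^sup>2 * ?L) \<le> 1 * 5"
    unfolding norm_mult using L by (intro mult_mono) auto
  have "exp \<bar>Im \<zeta>\<bar> \<le> exp 1" using \<zeta>(2) by simp
  then have "norm (cos \<zeta>) \<le> 3"
    using norm_sin_cos_le_exp(2)[of \<zeta>] exp_le by linarith
  then have "norm (of_real d * cos \<zeta>) \<le> (pi / 2) * 3"
    unfolding norm_mult using md by (intro mult_mono) auto
  then have C: "norm (of_real d * cos \<zeta>) \<le> 5" using pi_approx by simp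
  have "0 \<le> 1 / (2 * Re \<zeta>)" using \<zeta>(1) by simp
  then have "norm (1 - 1 / \<zeta>) \<le> 1" using norm_one_minus_inverse_le[OF \<zeta>] by linarith
  then have 2: "norm ((1 - 1 / \<zeta>) * (of_real d * cos \<zeta>)) \<le> 1 * 5"
    using C by (subst norm_mult, intro mult_mono) auto
  show "norm ?D \<le> 10"
    using norm_triangle_ineq[of "1 / \<zeta>\<^sup>2 * ?L" "(1 - 1 / \<zeta>) * (of_real d * cos \<zeta>)"] 1 2
    by linarith
qed

end

section \<open>The Koenigs function on the half plane\<close>

text \<open>The real part of \<open>u = Ln w\<close> is large while its imaginary part is less than \<open>\<pi>/2\<close> in modulus. So
  \<open>Ln u\<close> has imaginary part of order \<open>1 / \<bar>u\<bar>\<close> and real part \<open>ln \<bar>u\<bar>\<close>. The constant \<open>192\<close> makes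
  \<open>exp x \<ge> x\<^sup>2 / 2 \<ge> 96 x\<close> for \<open>x \<ge> 192\<close>; the last of the bounds is this estimate at \<open>x = ln \<bar>u\<bar>\<close>.\<close>

lemma iterated_log_bounds:
  assumes "exp (exp 192) < Re w"
  shows "\<bar>Im (Ln w)\<bar> < pi / 2" "exp 192 < Re (Ln w)" "192 < Re (Ln (Ln w))"
    "\<bar>Im (Ln (Ln w))\<bar> \<le> 4 / norm (Ln w)" "96 * Re (Ln (Ln w)) \<le> norm (Ln w)"
proof -
  define u where "u = Ln w"
  have w: "0 < Re w" using assms exp_gt_zero less_trans by blast
  then have [simp]: "w \<noteq> 0" by auto
  show im: "\<bar>Im (Ln w)\<bar> < pi / 2" using w Re_Ln_pos_lt_imp by blast
  have "exp (exp 192) < norm w" using assms complex_Re_le_cmod[of w] by linarith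
  then show re: "exp 192 < Re (Ln w)"
    using ln_less_cancel_iff[of "exp (exp 192)" "norm w"] by simp
  have "193 \<le> exp (192::real)" using exp_ge_add_one_self[of 192] by simp
  then have u: "193 < Re u" using re by (simp add: u_def)
  then have [simp]: "u \<noteq> 0" by auto
  have nu: "Re u \<le> norm u" "norm u \<le> Re u + \<bar>Im u\<bar>"
    using complex_Re_le_cmod cmod_le[of u] u by auto
  have Reu: "Re (Ln u) = ln (norm u)" by simp
  have "exp 192 < norm u" using re nu by (simp add: u_def)
  then have "192 < ln (norm u)"
    using ln_less_cancel_iff[of "exp 192" "norm u"] by simp
  then show x: "192 < Re (Ln (Ln w))" using Reu by (simp add: u_def)
  have "norm u = exp (Re (Ln u))" by simp
  then have "(Re (Ln u))\<^sup>2 / 2 \<le> norm u"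
    using exp_lower_Taylor_quadratic[of "Re (Ln u)"] x by (simp add: u_def)
  moreover have "192 * Re (Ln u) \<le> (Re (Ln u))\<^sup>2"
    using x by (simp add: power2_eq_square u_def)
  ultimately show "96 * Re (Ln (Ln w)) \<le> norm (Ln w)" by (simp add: u_def)
  have "Im (Ln u) = arctan (Im u / Re u)"
    using arg_conv_arctan[of u] Arg_eq_Im_Ln[of u] u by simp
  then have "\<bar>Im (Ln u)\<bar> \<le> \<bar>Im u\<bar> / Re u"
    using abs_arctan_le[of "Im u / Re u"] u by simp
  also have "\<dots> \<le> 4 / norm u"
  proof -
    have "\<bar>Im u\<bar> \<le> 2" using im pi_less_4 by (simp add: u_def)
    moreover have "norm u \<le> 2 * Re u" using nu u calculation by linarith
    ultimately have "\<bar>Im u\<bar> * norm u \<le> 2 * (2 * Re u)"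
      using u by (intro mult_mono) auto
    then show ?thesis using u by (simp add: field_simps)
  qed
  finally show "\<bar>Im (Ln (Ln w))\<bar> \<le> 4 / norm (Ln w)" by (simp add: u_def)
qed

text \<open>A square root of \<open>w exp (- \<i> g)\<close> with \<open>g = damped_sine m d (Ln (Ln w))\<close>: it is nearly positive
  where \<open>w\<close> points in the direction \<open>g\<close>.\<close>

definition slow_koenigs :: "real \<Rightarrow> real \<Rightarrow> complex \<Rightarrow> complex" where
  "slow_koenigs m d w = exp ((Ln w - \<i> * damped_sine m d (Ln (Ln w))) / 2)"

context
  fixes m d :: real and w :: complex
  assumes md: "0 \<le> d" "\<bar>m\<bar> + d \<le> pi / 2" and w: "exp (exp 192) < Re w"
begin

lemma iterated_log_range:
  "2 \<le> Re (Ln (Ln w))" "\<bar>Im (Ln (Ln w))\<bar> \<le> 1" "\<bar>Im (Ln (Ln w))\<bar> \<le> 1 / Re (Ln (Ln w))"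
proof -
  note b = iterated_log_bounds[OF w]
  show "2 \<le> Re (Ln (Ln w))" using b by simp
  have "4 / norm (Ln w) \<le> 4 / (96 * Re (Ln (Ln w)))"
    by (rule divide_left_mono[OF b(5)]) (use b(3,5) in \<open>auto intro!: mult_pos_pos\<close>)
  also have "\<dots> \<le> 1 / Re (Ln (Ln w))" using b(3) by (simp add: field_simps)
  finally show *: "\<bar>Im (Ln (Ln w))\<bar> \<le> 1 / Re (Ln (Ln w))" using b by linarith
  have "1 / Re (Ln (Ln w)) \<le> 1" using b by simp
  then show "\<bar>Im (Ln (Ln w))\<bar> \<le> 1" using * by linarith
qed

text \<open>The gain from damping beats all errors: with \<open>q = 1 / \<bar>Ln w\<bar>\<close> and \<open>x = ln \<bar>Ln w\<bar>\<close>, damping gains the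
  factor \<open>1 - 1 / (2 x) \<le> 1 - 48 q\<close>, while the growth of the sine costs at most the factor
  \<open>1 + 8 q\<close>. What is left, \<open>40 q\<close>, absorbs the correction in the derivative below.\<close>

lemma Re_damped_sine_slack:
  "\<bar>Re (damped_sine m d (Ln (Ln w)))\<bar> + 40 / norm (Ln w) \<le> pi / 2"
proof -
  note b = iterated_log_bounds[OF w]
  define x q where "x = Re (Ln (Ln w))" and "q = 1 / norm (Ln w)"
  have x: "192 < x" using b by (simp add: x_def)
  have "q * (96 * x) \<le> 1"
  proof -
    have "0 < norm (Ln w)" using b(3,5) by linarith
    then show ?thesis using b(5) by (simp add: q_def x_def field_simps)
  qed
  then have qx: "96 * q \<le> 1 / x" using x by (simp add: field_simps)
  have q: "0 \<le> q" by (simp add: q_def)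
  have "norm (damped_sine m d (Ln (Ln w))) \<le> (pi / 2) * (1 - 1 / (2 * x)) * (1 + 2 * \<bar>Im (Ln (Ln w))\<bar>)"
    unfolding x_def by (rule norm_damped_sine_le[OF md iterated_log_range(1,2)])
  also have "\<dots> \<le> (pi / 2) * (1 - 1 / (2 * x)) * (1 + 2 * (4 * q))"
    using b(4) x by (intro mult_left_mono) (auto simp: q_def)
  also have "\<dots> \<le> (pi / 2) * (1 - 40 * q)"
  proof -
    have "(1 - 1 / (2 * x)) * (1 + 2 * (4 * q)) \<le> 1 - 1 / (2 * x) + 8 * q"
      using x q by (simp add: algebra_simps)
    also have "\<dots> \<le> 1 - 40 * q" using qx by simp
    finally show ?thesis by (simp only: mult.assoc) (rule mult_left_mono, auto)
  qed
  also have "\<dots> = pi / 2 - (pi / 2) * (40 * q)" by (simp add: algebra_simps)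
  also have "\<dots> \<le> pi / 2 - 1 * (40 * q)"
    using mult_right_mono[of 1 "pi / 2" "40 * q"] q pi_ge_two by linarith
  finally show ?thesis
    using abs_Re_le_cmod[of "damped_sine m d (Ln (Ln w))"] by (simp add: q_def)
qed

text \<open>Here \<open>h' = h (1 - \<i> G / u) / (2 w)\<close>, where \<open>u = Ln w\<close> and \<open>G\<close> is the derivative of the damped sine
  at \<open>Ln u\<close>. Writing every factor as an exponential, \<open>h' = exp (\<kappa> - (u + \<i> g) / 2) / 2\<close> with
  \<open>\<kappa>\<close> of size at most \<open>20 / \<bar>u\<bar>\<close>, and positivity of the real part becomes a bound on the imaginary
  part of the exponent.\<close>

lemma slow_koenigs_derivative:
  obtains D where "(slow_koenigs m d has_field_derivative D) (at w)" "0 < Re D"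
proof -
  note b = iterated_log_bounds[OF w]
  define u g where "u = Ln w" and "g = damped_sine m d (Ln u)"
  have "0 < Re w" using w exp_gt_zero less_trans by blast
  then have w0: "w \<noteq> 0" "w \<notin> \<real>\<^sub>\<le>\<^sub>0"
    by (auto simp: complex_nonpos_Reals_iff)
  have u0: "u \<noteq> 0" "u \<notin> \<real>\<^sub>\<le>\<^sub>0"
    using less_trans[OF exp_gt_zero b(2)] by (auto simp: complex_nonpos_Reals_iff u_def)
  obtain G where G: "(damped_sine m d has_field_derivative G) (at (Ln u))" "norm G \<le> 10"
    using damped_sine_derivative[OF md iterated_log_range(1,2)] unfolding u_def by blast
  define \<kappa> where "\<kappa> = Ln (1 + - (\<i> * G / u))"
  define D where "D = slow_koenigs m d w * ((1 / w - \<i> * (G * (1 / u * (1 / w)))) / 2)"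
  have "((\<lambda>w. Ln (Ln w)) has_field_derivative 1 / u * (1 / w)) (at w)"
    using w0 u0 unfolding u_def by (auto intro!: derivative_eq_intros simp: divide_inverse)
  then have "((\<lambda>w. damped_sine m d (Ln (Ln w))) has_field_derivative G * (1 / u * (1 / w))) (at w)"
    using DERIV_chain2[of "damped_sine m d" G "\<lambda>w. Ln (Ln w)" w] G(1) unfolding u_def by blast
  then have der: "(slow_koenigs m d has_field_derivative D) (at w)"
    unfolding slow_koenigs_def[abs_def] D_def using w0
    by (auto intro!: derivative_eq_intros simp: u_def field_simps)
  have norm_u: "193 < norm u"
    using b(2) exp_ge_add_one_self[of 192] complex_Re_le_cmod[of u] by (simp add: u_def)
  have "norm (- (\<i> * G / u)) = norm G / norm u"
    by (simp add: norm_divide norm_mult)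
  also have "\<dots> \<le> 10 / norm u" using G(2) by (simp add: divide_right_mono)
  finally have small: "norm (- (\<i> * G / u)) \<le> 10 / norm u" .
  moreover have "10 / norm u < 1 / 2"
    using norm_u frac_less2[of 10 10 20 "norm u"] by simp
  ultimately have half: "norm (- (\<i> * G / u)) < 1 / 2" by linarith
  have \<kappa>: "norm \<kappa> \<le> 20 / norm u"
    using norm_Ln_le[OF half] small unfolding \<kappa>_def by simp
  have "1 + - (\<i> * G / u) \<noteq> 0" using half by (auto simp: add_eq_0_iff)
  then have exp_\<kappa>: "exp \<kappa> = 1 - \<i> * G / u" by (simp add: \<kappa>_def)
  have "D = slow_koenigs m d w * (1 / w) * (1 - \<i> * G / u) / 2"
    using w0 u0 by (simp add: D_def field_simps)
  also have "\<dots> = exp ((u - \<i> * g) / 2) * exp (- u) * exp \<kappa> / 2"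
    unfolding exp_\<kappa> using w0 by (simp add: slow_koenigs_def u_def g_def exp_minus field_simps)
  also have "\<dots> = exp (\<kappa> - (u + \<i> * g) / 2) / 2"
    by (simp flip: exp_add add: field_simps)
  finally have D: "D = exp (\<kappa> - (u + \<i> * g) / 2) / 2" .
  have "Im (\<kappa> - (u + \<i> * g) / 2) = Im \<kappa> - Im u / 2 - Re g / 2"
    by (simp add: field_simps)
  then have "\<bar>Im (\<kappa> - (u + \<i> * g) / 2)\<bar> \<le> \<bar>Im \<kappa>\<bar> + \<bar>Im u\<bar> / 2 + \<bar>Re g\<bar> / 2"
    by linarith
  also have "\<dots> < pi / 2"
    using \<kappa> abs_Im_le_cmod[of \<kappa>] Re_damped_sine_slack b(1) by (simp add: u_def g_def)
  finally have "0 < cos (Im (\<kappa> - (u + \<i> * g) / 2))"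
    by (intro cos_gt_zero_pi; linarith)
  then have "0 < Re D" unfolding D by (simp add: Re_exp)
  with der that show ?thesis by blast
qed

text \<open>The exponent lies in the strip where \<open>Ln\<close> inverts \<open>exp\<close>, so the argument of \<open>h w\<close> can be
  read off from it.\<close>

lemma Ln_slow_koenigs:
  "Ln (slow_koenigs m d w) = (Ln w - \<i> * damped_sine m d (Ln (Ln w))) / 2"
proof -
  let ?v = "(Ln w - \<i> * damped_sine m d (Ln (Ln w))) / 2"
  have "0 \<le> 40 / norm (Ln w)" by simp
  then have "\<bar>Re (damped_sine m d (Ln (Ln w)))\<bar> \<le> pi / 2" using Re_damped_sine_slack by linarith
  then have "\<bar>Im ?v\<bar> < pi"
    using iterated_log_bounds(1)[OF w] by simp
  then show ?thesis unfolding slow_koenigs_def by (intro Ln_exp) (auto simp: abs_less_iff)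
qed

text \<open>Up to a bounded factor \<open>h\<close> has the modulus of a square root; in particular it is proper.\<close>

lemma norm_le_slow_koenigs: "norm w \<le> exp 5 * (norm (slow_koenigs m d w))\<^sup>2"
proof -
  let ?g = "damped_sine m d (Ln (Ln w))"
  have w0: "w \<noteq> 0" using less_trans[OF exp_gt_zero w] by auto
  have "(slow_koenigs m d w)\<^sup>2 = exp (2 * ((Ln w - \<i> * ?g) / 2))"
    unfolding slow_koenigs_def by (rule exp_double[symmetric])
  moreover have "2 * ((Ln w - \<i> * ?g) / 2) = Ln w - \<i> * ?g" by simp
  ultimately have "(slow_koenigs m d w)\<^sup>2 = exp (Ln w - \<i> * ?g)" by metis
  then have "(norm (slow_koenigs m d w))\<^sup>2 = exp (ln (norm w) + Im ?g)"
    using w0 by (simp flip: norm_power add: norm_exp_eq_Re)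
  also have "\<dots> = norm w * exp (Im ?g)" using w0 by (simp add: exp_add)
  finally have "exp 5 * (norm (slow_koenigs m d w))\<^sup>2 = norm w * exp (5 + Im ?g)"
    by (simp add: exp_add)
  moreover have "0 \<le> 5 + Im ?g"
    using norm_damped_sine_le_5[OF md iterated_log_range(1,2)] abs_Im_le_cmod[of ?g] by linarith
  ultimately show ?thesis using mult_left_mono[of 1 "exp (5 + Im ?g)" "norm w"] by simp
qed

text \<open>This is what makes the trajectories oscillate: along them \<open>Arg (h w) \<longrightarrow> 0\<close>, so that \<open>Arg w\<close> follows
  the sine.\<close>

lemma Arg_near_oscillation:
  "\<bar>Arg w - 2 * Arg (slow_koenigs m d w) - (m + d * sin (Re (Ln (Ln w))))\<bar> \<le> 10 / Re (Ln (Ln w))"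
proof -
  let ?g = "damped_sine m d (Ln (Ln w))"
  have w0: "w \<noteq> 0" using less_trans[OF exp_gt_zero w] by auto
  have "slow_koenigs m d w \<noteq> 0" by (simp add: slow_koenigs_def)
  then have "Arg w - 2 * Arg (slow_koenigs m d w) = Re ?g"
    using w0 by (simp add: Arg_eq_Im_Ln Ln_slow_koenigs field_simps)
  then have "\<bar>Arg w - 2 * Arg (slow_koenigs m d w) - (m + d * sin (Re (Ln (Ln w))))\<bar>
      \<le> norm (?g - of_real (m + d * sin (Re (Ln (Ln w)))))"
    using abs_Re_le_cmod[of "?g - of_real (m + d * sin (Re (Ln (Ln w))))"] by simp
  also have "\<dots> \<le> 5 / Re (Ln (Ln w)) + 5 * \<bar>Im (Ln (Ln w))\<bar>"
    by (rule damped_sine_near_sine[OF md iterated_log_range(1,2)])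
  also have "\<dots> \<le> 10 / Re (Ln (Ln w))" using iterated_log_range(3) by simp
  finally show ?thesis .
qed

end

lemma Arg_add_of_real_tendsto_0: "((\<lambda>t. Arg (c + of_real t)) \<longlongrightarrow> 0) at_top"
proof -
  have "((\<lambda>t. c * of_real (1 / t) + 1) \<longlongrightarrow> c * of_real 0 + 1) at_top"
    by (intro tendsto_intros tendsto_divide_0[OF tendsto_const] filterlim_at_top_imp_at_infinity filterlim_ident)
  then have lim: "((\<lambda>t. c * of_real (1 / t) + 1) \<longlongrightarrow> 1) at_top" by simp
  have "isCont Arg 1" by (rule continuous_at_Arg) (simp add: complex_nonpos_Reals_iff)
  then have "((\<lambda>t. Arg (c * of_real (1 / t) + 1)) \<longlongrightarrow> 0) at_top"
    using isCont_tendsto_compose[OF _ lim] by fastforce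
  moreover have "\<forall>\<^sub>F t in at_top. Arg (c * of_real (1 / t) + 1) = Arg (c + of_real t)"
    using eventually_gt_at_top[of "0::real"]
  proof eventually_elim
    case (elim t)
    then have "c * of_real (1 / t) + 1 = (c + of_real t) / of_real t"
      by (simp add: field_simps)
    then show ?case using elim by (simp only: Arg_divide_of_real)
  qed
  ultimately show ?thesis using tendsto_cong by force
qed


lemma slow_koenigs_univalent:
  fixes m d :: real
  defines "P \<equiv> {w. exp (exp 192) < Re w}"
  assumes md: "0 \<le> d" "\<bar>m\<bar> + d \<le> pi / 2"
  shows "slow_koenigs m d holomorphic_on P" "inj_on (slow_koenigs m d) P"
    and "\<forall>w0\<in>P. \<forall>t\<ge>0. \<exists>w\<in>P. Re w0 \<le> Re w \<and> slow_koenigs m d w = slow_koenigs m d w0 + of_real t"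
proof -
  let ?h = "slow_koenigs m d"
  have "open P" "convex P"
    unfolding P_def by (rule open_halfspace_Re_gt convex_halfspace_Re_gt)+
  have der: "?h field_differentiable at w \<and> 0 < Re (deriv ?h w)" if w: "w \<in> P" for w
  proof -
    obtain D where D: "(?h has_field_derivative D) (at w)" "0 < Re D"
      using slow_koenigs_derivative[OF md] w unfolding P_def by blast
    then show ?thesis using DERIV_imp_deriv[OF D(1)] field_differentiable_def by blast
  qed
  show hol: "?h holomorphic_on P"
    unfolding holomorphic_on_def using der field_differentiable_at_within by blast
  have dq: "0 < Re ((?h b - ?h a) / (b - a))" if "a \<in> P" "b \<in> P" "a \<noteq> b" for a b
    by (rule Re_difference_quotient_pos[OF hol \<open>open P\<close> \<open>convex P\<close> _ that]) (use der in blast)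
  show inj: "inj_on ?h P"
  proof (rule inj_onI, rule ccontr)
    fix a b assume "a \<in> P" "b \<in> P" "?h a = ?h b" "a \<noteq> b"
    then show False using dq[of a b] by simp
  qed
  have proper: "\<exists>C. \<forall>w\<in>P. norm (?h w) \<le> B \<longrightarrow> norm w \<le> C" for B
  proof (intro exI ballI impI)
    fix w assume "w \<in> P" "norm (?h w) \<le> B"
    then have "norm w \<le> exp 5 * (norm (?h w))\<^sup>2"
      using norm_le_slow_koenigs[OF md] by (simp add: P_def)
    also have "\<dots> \<le> exp 5 * B\<^sup>2"
      using \<open>norm (?h w) \<le> B\<close> by (intro mult_left_mono power_mono) auto
    finally show "norm w \<le> exp 5 * B\<^sup>2" .
  qed
  have "\<exists>w\<in>P. Re w0 \<le> Re w \<and> ?h w = ?h w0 + of_real t" if "w0 \<in> P" "0 \<le> t" for w0 t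
    using horizontal_ray_in_image[OF hol[unfolded P_def] inj[unfolded P_def]
        dq[unfolded P_def] proper[unfolded P_def] that(1)[unfolded P_def] that(2)]
    unfolding P_def .
  then show "\<forall>w0\<in>P. \<forall>t\<ge>0. \<exists>w\<in>P. Re w0 \<le> Re w \<and> ?h w = ?h w0 + of_real t" by blast
qed

text \<open>The logarithm and the iterated logarithm of \<open>W t\<close> tend to infinity, so the phase of the sine passes through all large
  values.\<close>

lemma direction_of_trajectory:
  fixes W :: "real \<Rightarrow> complex"
  defines "x \<equiv> \<lambda>t. Re (Ln (Ln (W t)))"
  assumes md: "0 \<le> d" "\<bar>m\<bar> + d \<le> pi / 2"
    and cont: "continuous_on {0..} W" and esc: "filterlim W at_infinity at_top"
    and W: "\<And>t. 0 \<le> t \<Longrightarrow> exp (exp 192) < Re (W t)"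
      "\<And>t. 0 \<le> t \<Longrightarrow> slow_koenigs m d (W t) = c + of_real t"
  shows "continuous_on {0..} x" "filterlim x at_top at_top"
    "((\<lambda>t. Arg (W t) - (m + d * sin (x t))) \<longlongrightarrow> 0) at_top"
proof -
  have W0: "W t \<noteq> 0" "W t \<notin> \<real>\<^sub>\<le>\<^sub>0" if "0 \<le> t" for t
    using less_trans[OF exp_gt_zero W(1)[OF that]] by (auto simp: complex_nonpos_Reals_iff)
  have Ln_W: "Ln (W t) \<noteq> 0" "Ln (W t) \<notin> \<real>\<^sub>\<le>\<^sub>0" if "0 \<le> t" for t
    using less_trans[OF exp_gt_zero iterated_log_bounds(2)[OF W(1)[OF that]]]
    by (auto simp: complex_nonpos_Reals_iff)
  show "continuous_on {0..} x"
    unfolding x_def using cont W0 Ln_W by (intro continuous_intros) auto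
  have "filterlim (\<lambda>t. norm (W t)) at_top at_top"
    using esc by (rule filterlim_at_infinity_imp_norm_at_top)
  then have "filterlim (\<lambda>t. ln (norm (W t))) at_top at_top"
    by (rule filterlim_compose[OF ln_at_top])
  then have "filterlim (\<lambda>t. norm (Ln (W t))) at_top at_top"
  proof (rule filterlim_at_top_mono)
    show "\<forall>\<^sub>F t in at_top. ln (norm (W t)) \<le> norm (Ln (W t))"
      using eventually_ge_at_top[of 0]
    proof eventually_elim
      case (elim t)
      then show ?case using complex_Re_le_cmod[of "Ln (W t)"] W0(1) by simp
    qed
  qed
  then have "filterlim (\<lambda>t. ln (norm (Ln (W t)))) at_top at_top"
    by (rule filterlim_compose[OF ln_at_top])
  then show lim_x: "filterlim x at_top at_top"
  proof (rule filterlim_at_top_mono)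
    show "\<forall>\<^sub>F t in at_top. ln (norm (Ln (W t))) \<le> x t"
      using eventually_ge_at_top[of 0]
      by eventually_elim (simp add: x_def Ln_W(1))
  qed
  have "((\<lambda>t. Arg (W t) - 2 * Arg (c + of_real t) - (m + d * sin (x t))) \<longlongrightarrow> 0) at_top"
  proof (rule Lim_null_comparison)
    show "((\<lambda>t. 10 / x t) \<longlongrightarrow> 0) at_top"
      by (intro tendsto_divide_0[OF tendsto_const] filterlim_at_top_imp_at_infinity lim_x)
    show "\<forall>\<^sub>F t in at_top. norm (Arg (W t) - 2 * Arg (c + of_real t) - (m + d * sin (x t))) \<le> 10 / x t"
      using eventually_ge_at_top[of 0]
    proof eventually_elim
      case (elim t)
      show ?case
        using Arg_near_oscillation[OF md W(1)[OF elim]] W(2)[OF elim] by (simp add: x_def)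
    qed
  qed
  from tendsto_add[OF this tendsto_mult[OF tendsto_const Arg_add_of_real_tendsto_0], of 2 c]
  show "((\<lambda>t. Arg (W t) - (m + d * sin (x t))) \<longlongrightarrow> 0) at_top" by (simp add: algebra_simps)
qed


section \<open>Transfer to the disk\<close>

text \<open>The Moebius map \<open>z \<mapsto> 2 R / (1 - z)\<close> has inverse \<open>w \<mapsto> 1 - 2 R / w\<close>. The scale \<open>2 R\<close>
  is the one for which the image of the disk is exactly \<open>Re w > R\<close>, without a translation; this is why
  \<open>Arg (1 - z) = - Arg w\<close> holds with no error term.\<close>

lemma norm_less_one_imp_half_plane:
  assumes "0 < R" "norm z < 1"
  shows "R < Re (of_real (2 * R) / (1 - z))"
proof -
  have "(Re z)\<^sup>2 + (Im z)\<^sup>2 < 1"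
    using assms(2) by (simp flip: cmod_power2 add: abs_square_less_1)
  then have *: "(1 - Re z)\<^sup>2 + (Im z)\<^sup>2 < 2 * (1 - Re z)"
    by (simp add: power2_eq_square algebra_simps)
  have pos: "0 < (1 - Re z)\<^sup>2 + (Im z)\<^sup>2"
    using abs_Re_le_cmod[of z] assms(2) by (intro add_pos_nonneg) auto
  have "Re (of_real (2 * R) / (1 - z)) = R * (2 * (1 - Re z) / ((1 - Re z)\<^sup>2 + (Im z)\<^sup>2))"
    by (simp add: Re_divide)
  moreover have "R * 1 < R * (2 * (1 - Re z) / ((1 - Re z)\<^sup>2 + (Im z)\<^sup>2))"
    using * pos by (intro mult_strict_left_mono[OF _ \<open>0 < R\<close>]) (simp add: less_divide_eq)
  ultimately show ?thesis by simp
qed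

lemma half_plane_imp_norm_less_one:
  assumes "0 < R" "R < Re w"
  shows "norm (1 - of_real (2 * R) / w) < 1"
proof -
  have "w \<noteq> 0" using assms by auto
  have "R * R < R * Re w" using assms by simp
  then have "(norm (w - of_real (2 * R)))\<^sup>2 < (norm w)\<^sup>2"
    by (simp add: cmod_power2) (simp add: power2_eq_square algebra_simps)
  then have "norm (w - of_real (2 * R)) < norm w"
    by (rule power2_less_imp_less) simp
  moreover have "1 - of_real (2 * R) / w = (w - of_real (2 * R)) / w"
    using \<open>w \<noteq> 0\<close> by (simp add: field_simps)
  ultimately show ?thesis using \<open>w \<noteq> 0\<close> by (simp add: norm_divide)
qed

text \<open>A curve that stays in \<open>r \<le> Re w\<close> can only meet a ball while \<open>h\<close> is bounded by its maximum over the
  compact part of \<open>r \<le> Re w\<close> inside the ball, whereas \<open>\<bar>c + t\<bar>\<close> exceeds any bound.\<close>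

lemma curve_escapes_to_infinity:
  fixes h :: "complex \<Rightarrow> complex"
  assumes cont: "continuous_on {w. R < Re w} h" and "R < r"
    and W: "\<And>t. 0 \<le> t \<Longrightarrow> r \<le> Re (W t)" "\<And>t. 0 \<le> t \<Longrightarrow> h (W t) = c + of_real t"
  shows "filterlim W at_infinity at_top"
  unfolding filterlim_at_infinity[OF order_refl]
proof (intro allI impI)
  fix B :: real
  let ?K = "{w. r \<le> Re w} \<inter> cball 0 B"
  have "compact ?K" by (simp add: closed_Int_compact closed_halfspace_Re_ge)
  moreover have "continuous_on ?K h"
    using cont by (rule continuous_on_subset) (use \<open>R < r\<close> in auto)
  ultimately have "bounded (h ` ?K)"
    using compact_continuous_image compact_imp_bounded by blast
  then obtain M where M: "\<And>w. w \<in> ?K \<Longrightarrow> norm (h w) \<le> M"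
    unfolding bounded_iff by blast
  show "\<forall>\<^sub>F t in at_top. B \<le> norm (W t)"
    using eventually_gt_at_top[of "max 0 (M + norm c)"]
  proof eventually_elim
    case (elim t)
    then have "norm (h (W t)) > M"
      using W(2)[of t] norm_triangle_ineq2[of "of_real t" "- c"] by (simp add: add.commute)
    then have "W t \<notin> ?K" using M by force
    then show ?case using W(1)[of t] elim by simp
  qed
qed

text \<open>The semigroup is \<open>w \<mapsto> h\<^sup>-\<^sup>1 (h w + t)\<close> in the coordinate \<open>w = 2 R / (1 - z)\<close>. Orbits move to the right
  and so keep their distance from the boundary line; the only way out is infinity, which is the
  point \<open>1\<close> of the circle.\<close>

lemma semigroup_of_half_plane:
  fixes h :: "complex \<Rightarrow> complex" and R :: real
  assumes "0 < R" and hol_h: "h holomorphic_on {w. R < Re w}" and inj_h: "inj_on h {w. R < Re w}"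
    and ray_h: "\<forall>w0\<in>{w. R < Re w}. \<forall>t\<ge>0. \<exists>w\<in>{w. R < Re w}. Re w0 \<le> Re w \<and> h w = h w0 + of_real t"
  obtains \<phi> H where "holo_semigroup \<phi>" "non_elliptic \<phi>" "is_koenigs_function \<phi> H"
    "is_denjoy_wolff_point \<phi> 1"
    "\<And>z. z \<in> unit_disk \<Longrightarrow> continuous_on {0..} (\<lambda>t. of_real (2 * R) / (1 - \<phi> t z))"
    "\<And>z. z \<in> unit_disk \<Longrightarrow> filterlim (\<lambda>t. of_real (2 * R) / (1 - \<phi> t z)) at_infinity at_top"
    "\<And>z t. \<lbrakk>z \<in> unit_disk; 0 \<le> t\<rbrakk> \<Longrightarrow> R < Re (of_real (2 * R) / (1 - \<phi> t z))"
    "\<And>z t. \<lbrakk>z \<in> unit_disk; 0 \<le> t\<rbrakk> \<Longrightarrow> h (of_real (2 * R) / (1 - \<phi> t z)) = H z + of_real t"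
proof -
  define P where "P = {w. R < Re w}"
  define C where "C = (\<lambda>z::complex. of_real (2 * R) / (1 - z))"
  define H where "H = (\<lambda>z. h (C z))"
  define \<phi> where "\<phi> = (\<lambda>t z. inv_into unit_disk H (H z + of_real t))"
  note hol_h = hol_h[folded P_def] and inj_h = inj_h[folded P_def] and ray_h = ray_h[folded P_def]
  have C_inverse: "1 - of_real (2 * R) / C z = z" for z
    using \<open>0 < R\<close> by (simp add: C_def)
  have C_in: "C z \<in> P" if "z \<in> unit_disk" for z
    using norm_less_one_imp_half_plane[OF \<open>0 < R\<close>] that by (simp add: C_def P_def)
  have C_onto: "w \<in> C ` unit_disk" if "w \<in> P" for w
  proof (rule image_eqI)
    have "w \<noteq> 0" using that \<open>0 < R\<close> by (auto simp: P_def)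
    then show "w = C (1 - of_real (2 * R) / w)" using \<open>0 < R\<close> by (simp add: C_def)
    show "1 - of_real (2 * R) / w \<in> unit_disk"
      using half_plane_imp_norm_less_one[OF \<open>0 < R\<close>] that by (simp add: P_def)
  qed
  have hol_C: "C holomorphic_on unit_disk"
    unfolding C_def by (intro holomorphic_intros) auto
  have inj_C: "inj_on C unit_disk"
    by (rule inj_on_inverseI) (rule C_inverse)
  have H_comp: "H = h \<circ> C" by (simp add: H_def fun_eq_iff)
  have hol_H: "H holomorphic_on unit_disk"
    unfolding H_comp by (rule holomorphic_on_compose_gen[OF hol_C hol_h]) (use C_in in blast)
  have "C ` unit_disk \<subseteq> P" using C_in by blast
  then have inj_H: "inj_on H unit_disk"
    unfolding H_comp by (intro comp_inj_on[OF inj_C] inj_on_subset[OF inj_h])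
  have ray_H: "\<forall>z\<in>unit_disk. \<forall>t\<ge>0. H z + of_real t \<in> H ` unit_disk"
  proof (intro ballI allI impI)
    fix z and t :: real assume z: "z \<in> unit_disk" and t: "0 \<le> t"
    obtain w where w: "w \<in> P" "h w = H z + of_real t"
      using ray_h[rule_format, OF C_in[OF z] t] by (auto simp: H_def)
    obtain z' where "z' \<in> unit_disk" "w = C z'"
      using C_onto[OF w(1)] by blast
    then show "H z + of_real t \<in> H ` unit_disk"
      using w(2) by (intro image_eqI[of _ _ z']) (auto simp: H_def)
  qed
  have sg: "holo_semigroup \<phi>" "non_elliptic \<phi>" "is_koenigs_function \<phi> H"
    unfolding \<phi>_def by (rule semigroup_of_koenigs_domain[OF hol_H inj_H ray_H])+
  have cont_\<phi>: "continuous_on {0..} (\<lambda>t. \<phi> t z)" if "z \<in> unit_disk" for z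
    unfolding \<phi>_def
    by (rule semigroup_of_koenigs_domain(4)[OF hol_H inj_H ray_H that])
  have in_disk: "\<phi> t z \<in> unit_disk" if "z \<in> unit_disk" "0 \<le> t" for t z
    using sg(1) that unfolding holo_semigroup_def by blast
  have W_in: "C (\<phi> t z) \<in> P" if "z \<in> unit_disk" "0 \<le> t" for t z
    by (rule C_in[OF in_disk[OF that]])
  have hW: "h (C (\<phi> t z)) = H z + of_real t" if "z \<in> unit_disk" "0 \<le> t" for t z
    using sg(3) that unfolding is_koenigs_function_def H_def by blast
  have cont_W: "continuous_on {0..} (\<lambda>t. C (\<phi> t z))" if "z \<in> unit_disk" for z
    by (rule continuous_on_compose2[OF holomorphic_on_imp_continuous_on[OF hol_C] cont_\<phi>[OF that]])
       (use in_disk[OF that] in auto)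
  have escape: "filterlim (\<lambda>t. C (\<phi> t z)) at_infinity at_top" if z: "z \<in> unit_disk" for z
  proof (rule curve_escapes_to_infinity)
    show "continuous_on {w. R < Re w} h"
      using holomorphic_on_imp_continuous_on[OF hol_h] by (simp add: P_def)
    show "R < Re (C z)" using C_in[OF z] by (simp add: P_def)
    fix t :: real assume t: "0 \<le> t"
    show "h (C (\<phi> t z)) = H z + of_real t" by (rule hW[OF z t])
    obtain w where w: "w \<in> P" "Re (C z) \<le> Re w" "h w = H z + of_real t"
      using ray_h[rule_format, OF C_in[OF z] t] by (auto simp: H_def)
    have "w = C (\<phi> t z)"
      by (rule inj_onD[OF inj_h _ w(1) W_in[OF z t]]) (simp add: w(3) hW[OF z t])
    then show "Re (C z) \<le> Re (C (\<phi> t z))" using w(2) by simp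
  qed
  have dw: "is_denjoy_wolff_point \<phi> 1"
    unfolding is_denjoy_wolff_point_def
  proof (intro conjI ballI)
    fix z assume z: "z \<in> unit_disk"
    have "((\<lambda>t. 1 - of_real (2 * R) / C (\<phi> t z)) \<longlongrightarrow> 1 - 0) at_top"
      by (intro tendsto_diff tendsto_const tendsto_divide_0[OF tendsto_const escape[OF z]])
    then show "((\<lambda>t. \<phi> t z) \<longlongrightarrow> 1) at_top" unfolding C_inverse by simp
  qed simp
  show thesis
  proof
    show "holo_semigroup \<phi>" "non_elliptic \<phi>" "is_koenigs_function \<phi> H" by (rule sg)+
    show "is_denjoy_wolff_point \<phi> 1" by (rule dw)
  qed (use cont_W escape W_in hW in \<open>simp_all add: C_def P_def\<close>)
qed

theorem theorem1:
  fixes \<theta>1 \<theta>2 :: real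
  assumes "\<theta>1 < \<theta>2" and "\<bar>\<theta>1\<bar> \<le> pi / 2" and "\<bar>\<theta>2\<bar> \<le> pi / 2"
  shows "\<exists>\<phi> \<xi> h. holo_semigroup \<phi> \<and> non_elliptic \<phi> \<and>
           is_denjoy_wolff_point \<phi> \<xi> \<and> is_koenigs_function \<phi> h \<and>
           (\<forall>z\<in>unit_disk. slope_plus \<xi> h z = {\<theta>1..\<theta>2})"
proof -
  \<comment> \<open>The slopes are the negatives of the directions of \<open>w\<close>, whence the sign of \<open>m\<close>.\<close>
  define m d R where "m = - (\<theta>1 + \<theta>2) / 2" and "d = (\<theta>2 - \<theta>1) / 2"
    and "R = exp (exp (192::real))"
  have md: "0 \<le> d" "\<bar>m\<bar> + d \<le> pi / 2" and "0 < d"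
    using assms by (auto simp: m_def d_def abs_le_iff abs_if field_simps)
  have "0 < R" by (simp add: R_def)
  obtain \<phi> H where sg: "holo_semigroup \<phi>" "non_elliptic \<phi>" "is_koenigs_function \<phi> H"
      "is_denjoy_wolff_point \<phi> 1"
    and cont: "\<And>z. z \<in> unit_disk \<Longrightarrow> continuous_on {0..} (\<lambda>t. of_real (2 * R) / (1 - \<phi> t z))"
    and escape: "\<And>z. z \<in> unit_disk \<Longrightarrow> filterlim (\<lambda>t. of_real (2 * R) / (1 - \<phi> t z)) at_infinity at_top"
    and half_plane: "\<And>z t. \<lbrakk>z \<in> unit_disk; 0 \<le> t\<rbrakk> \<Longrightarrow> R < Re (of_real (2 * R) / (1 - \<phi> t z))"
    and level: "\<And>z t. \<lbrakk>z \<in> unit_disk; 0 \<le> t\<rbrakk> \<Longrightarrow>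
      slow_koenigs m d (of_real (2 * R) / (1 - \<phi> t z)) = H z + of_real t"
    using semigroup_of_half_plane[OF \<open>0 < R\<close> slow_koenigs_univalent[OF md, folded R_def]] by blast
  have "slope_plus 1 H z = {\<theta>1..\<theta>2}" if z: "z \<in> unit_disk" for z
  proof -
    define W where "W = (\<lambda>t. of_real (2 * R) / (1 - \<phi> t z))"
    define x where "x = (\<lambda>t. Re (Ln (Ln (W t))))"
    have cont_W: "continuous_on {0..} W" and escape_W: "filterlim W at_infinity at_top"
      unfolding W_def by (rule cont[OF z] escape[OF z])+
    have level_W: "slow_koenigs m d (W t) = H z + of_real t" if "0 \<le> t" for t
      unfolding W_def by (rule level[OF z that])
    have W_in: "exp (exp 192) < Re (W t)" if "0 \<le> t" for t
      using half_plane[OF z that] by (simp add: W_def R_def)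
    have osc: "continuous_on {0..} x" "filterlim x at_top at_top"
      "((\<lambda>t. Arg (W t) - (m + d * sin (x t))) \<longlongrightarrow> 0) at_top"
      unfolding x_def
      by (rule direction_of_trajectory[OF md cont_W escape_W W_in level_W]; assumption)+
    have lim: "((\<lambda>t. - Arg (W t) - (- m - d * sin (x t))) \<longlongrightarrow> 0) at_top"
      using tendsto_minus[OF osc(3)] by (simp add: algebra_simps)
    have Arg_eq: "Arg (1 - cnj 1 * trajectory H z t) = - Arg (W t)" if "0 \<le> t" for t
    proof -
      have "0 < Re (W t)" using less_trans[OF exp_gt_zero W_in[OF that]] .
      then have W0: "W t \<noteq> 0" "W t \<notin> \<real>\<^sub>\<le>\<^sub>0"
        by (auto simp: complex_nonpos_Reals_iff)
      have "trajectory H z t = \<phi> t z"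
        by (rule trajectory_eq_semigroup[OF sg(1,3) z that])
      then have "1 - cnj 1 * trajectory H z t = of_real (2 * R) * inverse (W t)"
        using \<open>0 < R\<close> by (simp add: W_def)
      then have "Arg (1 - cnj 1 * trajectory H z t) = Arg (inverse (W t))"
        using \<open>0 < R\<close> by (simp only: Arg_times_of_real mult_pos_pos zero_less_numeral)
      also have "\<dots> = - Arg (W t)"
        using W0 by (simp add: Arg_eq_Im_Ln Ln_inverse)
      finally show ?thesis .
    qed
    have "\<forall>\<^sub>F t in at_top. - Arg (W t) - (- m - d * sin (x t)) =
        Arg (1 - cnj 1 * trajectory H z t) - (- m - d * sin (x t))"
      using eventually_ge_at_top[of 0] by eventually_elim (simp only: Arg_eq)
    from tendsto_cong[THEN iffD1, OF this lim]
    have "((\<lambda>t. Arg (1 - cnj 1 * trajectory H z t) - (- m - d * sin (x t))) \<longlongrightarrow> 0) at_top" .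
    from slope_plus_of_oscillation[OF z \<open>0 < d\<close> osc(1,2) this]
    show ?thesis by (simp add: m_def d_def field_simps)
  qed
  then show ?thesis using sg by blast
qed

end
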